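(* Let $F=(F,\mathcal T,\nu,\mathcal G)$ be a $\nu$-archimedean, $\nu$-bipotent $\nu$-semifield$^\dagger$ and $\Lambda=\{\lambda_1,\dots,\lambda_n\}$. If $K$ is a $\mathcal K$-kernel of $\overline{F(\Lambda)}$, then $K':=K\cap\langle F\rangle$ is a $\mathcal K$-kernel of $\langle F\rangle$ satisfying $1_{\mathrm{loc}}(K)=1_{\mathrm{loc}}(K')$.
   Context: **$\nu$-structures.** A semiring$^\dagger$ is a commutative semiring with unit $1$, not required to have a zero (and containing $r_0,r_1$ with $r_0+r_1=1$). A $\nu$-domain$^\dagger$ is a quadruple $(R,\mathcal T,\nu,\mathcal G)$ with $R$ a semiring$^\dagger$, $\mathcal T\subset R$ a cancellative multiplicative submonoid (tangible elements), $\mathcal G$ an ideal of $R$ (ghost elements) with a partial order, and $\nu:R\to\mathcal G$ an idempotent homomorphism with $\nu|_{\mathcal T}$ onto, such that $a+b=a$ if $\nu(a)>\nu(b)$ and $a+b=\nu(a)$ if $\nu(a)=\nu(b)$. It is a $\nu$-semifield$^\dagger$ if $\mathcal T$ is an abelian group, $\nu$-bipotent if $a+b\in\{a,b,a^\nu\}$ always, $\nu$-archimedean if $a^{k}\le_\nu b$ for all $k\in\mathbb Z$ implies $a\cong_\nu1$. Write $a^\nu=\nu(a)$; $a\cong_\nu b$ means $a^\nu=b^\nu$; $a\ge_\nu b$ means $a^\nu\ge b^\nu$. Set $a^*=a^{-1}$, $(a^\nu)^*=(a^{-1})^\nu$ for $a\in\mathcal T$. $F$ is assumed nontrivial: some element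 is not $\cong_\nu 1$. **Rational functions.** $\overline{F[\Lambda]}$ is the semiring$^\dagger$ of functions $F^{(n)}\to F$ defined by polynomials over $F$, and $\overline{\mathcal T[\Lambda]}$ its subset defined by polynomials with tangible coefficients. $\overline{F(\Lambda)}$ is the localization of $\overline{F[\Lambda]}$ at $\overline{\mathcal T[\Lambda]}$; its elements $h/g$ are regarded as functions $\mathbf a\mapsto h(\mathbf a)g(\mathbf a)^*$ with pointwise operations. **Kernels.** A $\nu$-kernel of $\overline{F(\Lambda)}$ is a subgroup $K$ (closed under products and $*$) such that $a,b\in K$, $\alpha+\beta\cong_\nu1$ imply $\alpha a+\beta b\in K$; these are handled up to $\cong_\nu$. $\langle F\rangle$ is the $\nu$-kernel generated by the constant functions (equivalently by any constant $\alpha\not\cong_\nu1$). For a set $S$ of rational functions, $1_{\mathrm{loc}}(S)=\{\mathbf a\in F^{(n)}: f(\mathbf a)\cong_\nu1\ \forall f\in S\}$; such sets are the $1^\nu$-sets. For $Z\subseteq F^{(n)}$, $\mathcal Kern(Z)=\{f\in\overline{F(\Lambda)}: f(\mathbf a)\cong_\nu1\ \forall\mathbf a\in Z\}$. A $\mathcal K$-kernel of $\overline{F(\Lambda)}$ is a $\nu$-kernel $\mathcal Kern(Z)$ with $Z$ a $1^\nu$-set; a $\mathcal K$-kernel of $\langle F\rangle$ is one of the form $\mathcal Kern(Z)\cap\langle F\rangle$ with $Z$ a $1^\nu$-set. *)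

theory Defs
  imports Complex_Main
begin

(* A commutative semiring with 1 but without a postulated 0.  The whole type plays the role
   of the underlying semiring. *)
class semiring_dagger = comm_semiring + comm_monoid_mult +
  assumes ex_sum_one: "\<exists>r0 r1. r0 + r1 = 1"

(* T: tangible elements; G: ghost ideal; ord: the partial order of G, as a set of pairs
   (smaller, larger).  \<nu> is a homomorphism onto G, whose unit is \<nu> 1, so \<nu> 1 = 1 is
   not required. *)
locale nu_domain =
  fixes T :: "'a::semiring_dagger set"
    and \<nu> :: "'a \<Rightarrow> 'a"
    and G :: "'a set"
    and ord :: "('a \<times> 'a) set"
  assumes T_one: "1 \<in> T"
    and T_mult: "\<And>a b. a \<in> T \<Longrightarrow> b \<in> T \<Longrightarrow> a * b \<in> T"
    and T_cancel: "\<And>a b c. a \<in> T \<Longrightarrow> b \<in> T \<Longrightarrow> c \<in> T \<Longrightarrow> a * b = a * c \<Longrightarrow> b = c"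
    and G_add: "\<And>x y. x \<in> G \<Longrightarrow> y \<in> G \<Longrightarrow> x + y \<in> G"
    and G_ideal: "\<And>r x. x \<in> G \<Longrightarrow> r * x \<in> G"
    and G_ord: "partial_order_on G ord"
    and nu_add: "\<And>a b. \<nu> (a + b) = \<nu> a + \<nu> b"
    and nu_mult: "\<And>a b. \<nu> (a * b) = \<nu> a * \<nu> b"
    and nu_range: "\<And>a. \<nu> a \<in> G"
    and nu_idem: "\<And>a. \<nu> (\<nu> a) = \<nu> a"
    and nu_T_onto: "\<nu> ` T = G"
    and add_dominant: "\<And>a b. (\<nu> b, \<nu> a) \<in> ord \<Longrightarrow> \<nu> b \<noteq> \<nu> a \<Longrightarrow> a + b = a"
    and add_equal: "\<And>a b. \<nu> a = \<nu> b \<Longrightarrow> a + b = \<nu> a"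

locale nu_semifield = nu_domain +
  assumes T_group: "\<And>a. a \<in> T \<Longrightarrow> \<exists>b\<in>T. a * b = 1"

definition nu_bipotent :: "('a::semiring_dagger \<Rightarrow> 'a) \<Rightarrow> bool" where
  "nu_bipotent \<nu> \<longleftrightarrow> (\<forall>a b. a + b \<in> {a, b, \<nu> a})"

definition nu_nontrivial :: "('a::semiring_dagger \<Rightarrow> 'a) \<Rightarrow> bool" where
  "nu_nontrivial \<nu> \<longleftrightarrow> (\<exists>a. \<nu> a \<noteq> \<nu> 1)"

definition tang_inv :: "'a::semiring_dagger set \<Rightarrow> 'a \<Rightarrow> 'a" where
  "tang_inv T a = (THE b. b \<in> T \<and> a * b = 1)"

(* The inverse on T, and (\<nu> a)^* = \<nu> (a^{-1}) for a in T; the chosen preimage t is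
   immaterial, and the two branches agree on the intersection of T and G.  Elements lying
   neither in T nor in G (the axioms do not exclude them) are treated like ghosts. *)
definition star :: "'a::semiring_dagger set \<Rightarrow> ('a \<Rightarrow> 'a) \<Rightarrow> 'a \<Rightarrow> 'a" where
  "star T \<nu> x =
     (if x \<in> T then tang_inv T x
      else \<nu> (tang_inv T (SOME t. t \<in> T \<and> \<nu> t = \<nu> x)))"

definition int_power :: "'a::semiring_dagger set \<Rightarrow> ('a \<Rightarrow> 'a) \<Rightarrow> 'a \<Rightarrow> int \<Rightarrow> 'a" where
  "int_power T \<nu> a k = (if 0 \<le> k then a ^ nat k else star T \<nu> a ^ nat (- k))"

definition nu_archimedean ::
    "'a::semiring_dagger set \<Rightarrow> ('a \<Rightarrow> 'a) \<Rightarrow> ('a \<times> 'a) set \<Rightarrow> bool" where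
  "nu_archimedean T \<nu> ord \<longleftrightarrow>
     (\<forall>a b. (\<forall>k::int. (\<nu> (int_power T \<nu> a k), \<nu> b) \<in> ord) \<longrightarrow> \<nu> a = \<nu> 1)"

(* Points of F^(n) are functions on a finite index type 'n (so CARD('n) = n). *)

definition monomial :: "'a::semiring_dagger \<Rightarrow> ('n::finite \<Rightarrow> nat) \<Rightarrow> ('n \<Rightarrow> 'a) \<Rightarrow> 'a" where
  "monomial c m a = c * (\<Prod>i\<in>UNIV. a i ^ m i)"

(* poly_on C M p: p is the function of a polynomial with support exactly M and all
   coefficients in C.  Supports are nonempty, as there is no 0.  The monomials of M must be
   distinct: otherwise \<lambda> + \<lambda>, whose coefficient is the ghost \<nu> 1, would
   count as having tangible coefficients. *)
inductive poly_on ::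
    "'a::semiring_dagger set \<Rightarrow> ('n::finite \<Rightarrow> nat) set \<Rightarrow> (('n \<Rightarrow> 'a) \<Rightarrow> 'a) \<Rightarrow> bool"
  for C where
  single: "c \<in> C \<Longrightarrow> poly_on C {m} (monomial c m)"
| insert: "poly_on C M p \<Longrightarrow> m \<notin> M \<Longrightarrow> c \<in> C \<Longrightarrow>
     poly_on C (insert m M) (\<lambda>a. monomial c m a + p a)"

definition poly_fun ::
    "'a::semiring_dagger set \<Rightarrow> (('n::finite \<Rightarrow> 'a) \<Rightarrow> 'a) set" where
  "poly_fun C = {p. \<exists>M. poly_on C M p}"

definition rat_fun ::
    "'a::semiring_dagger set \<Rightarrow> ('a \<Rightarrow> 'a) \<Rightarrow> (('n::finite \<Rightarrow> 'a) \<Rightarrow> 'a) set" where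
  "rat_fun T \<nu> =
     {f. \<exists>h \<in> poly_fun UNIV. \<exists>g \<in> poly_fun T. f = (\<lambda>a. h a * star T \<nu> (g a))}"

(* All functions that are \<nu>-equivalent, pointwise, to some member of K. *)
definition upto_nu :: "('a \<Rightarrow> 'a) \<Rightarrow> ('p \<Rightarrow> 'a) set \<Rightarrow> ('p \<Rightarrow> 'a) set" where
  "upto_nu \<nu> K = {f. \<exists>g\<in>K. \<forall>a. \<nu> (f a) = \<nu> (g a)}"

(* \<nu>-kernels of the ambient set A of functions.  Kernels are read up to \<nu>-equivalence:
   they are saturated in A, and pointwise results need only lie in K up to \<nu>-equivalence.
   The latter is essential, because the pointwise sum of two functions of the form h/g
   is in general of this form only up to \<nu>-equivalence. *)
definition nu_kernel ::
    "'a::semiring_dagger set \<Rightarrow> ('a \<Rightarrow> 'a) \<Rightarrow> ('p \<Rightarrow> 'a) set \<Rightarrow> ('p \<Rightarrow> 'a) set \<Rightarrow> bool" where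
  "nu_kernel T \<nu> A K \<longleftrightarrow>
     K = A \<inter> upto_nu \<nu> K \<and>
     (\<lambda>_. 1) \<in> K \<and>
     (\<forall>f\<in>K. \<forall>g\<in>K. (\<lambda>a. f a * g a) \<in> upto_nu \<nu> K) \<and>
     (\<forall>f\<in>K. (\<lambda>a. star T \<nu> (f a)) \<in> upto_nu \<nu> K) \<and>
     (\<forall>f\<in>K. \<forall>g\<in>K. \<forall>\<alpha>\<in>A. \<forall>\<beta>\<in>A.
        (\<forall>a. \<nu> (\<alpha> a + \<beta> a) = \<nu> 1) \<longrightarrow>
        (\<lambda>a. \<alpha> a * f a + \<beta> a * g a) \<in> upto_nu \<nu> K)"

(* The \<nu>-kernel of the rational functions generated by the constant functions. *)
definition const_kernel ::
    "'a::semiring_dagger set \<Rightarrow> ('a \<Rightarrow> 'a) \<Rightarrow> (('n::finite \<Rightarrow> 'a) \<Rightarrow> 'a) set" where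
  "const_kernel T \<nu> =
     \<Inter> {K. nu_kernel T \<nu> (rat_fun T \<nu>) K \<and> (\<forall>c. (\<lambda>_. c) \<in> K)}"

definition one_loc ::
    "('a::semiring_dagger \<Rightarrow> 'a) \<Rightarrow> ('p \<Rightarrow> 'a) set \<Rightarrow> 'p set" where
  "one_loc \<nu> S = {a. \<forall>f\<in>S. \<nu> (f a) = \<nu> 1}"

definition one_set ::
    "'a::semiring_dagger set \<Rightarrow> ('a \<Rightarrow> 'a) \<Rightarrow> ('n::finite \<Rightarrow> 'a) set \<Rightarrow> bool" where
  "one_set T \<nu> Z \<longleftrightarrow> (\<exists>S \<subseteq> rat_fun T \<nu>. Z = one_loc \<nu> S)"

definition Kern ::
    "'a::semiring_dagger set \<Rightarrow> ('a \<Rightarrow> 'a) \<Rightarrow> ('n::finite \<Rightarrow> 'a) set \<Rightarrow>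
     (('n \<Rightarrow> 'a) \<Rightarrow> 'a) set" where
  "Kern T \<nu> Z = {f \<in> rat_fun T \<nu>. \<forall>a\<in>Z. \<nu> (f a) = \<nu> 1}"

(* To be used with A = rat_fun T \<nu> (where the intersection with A is redundant) and with
   A = const_kernel T \<nu>. *)
definition K_kernel ::
    "'a::semiring_dagger set \<Rightarrow> ('a \<Rightarrow> 'a) \<Rightarrow> (('n::finite \<Rightarrow> 'a) \<Rightarrow> 'a) set \<Rightarrow>
     (('n \<Rightarrow> 'a) \<Rightarrow> 'a) set \<Rightarrow> bool" where
  "K_kernel T \<nu> A K \<longleftrightarrow>
     nu_kernel T \<nu> A K \<and> (\<exists>Z. one_set T \<nu> Z \<and> K = Kern T \<nu> Z \<inter> A)"

end

(* Every w with w^\<nu> = |f|^{-1} + d, where |f| = f + f^{-1} and d < 1 is a constant, satisfies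
   w = 1 exactly where f = 1.  As 1 + |f|^{-1} = 1, the kernel axiom for sums puts w into
   each kernel that contains the constants.  Hence truncating the members of K yields
   members of K in <F> with the same 1-locus.  The argument takes place in the totally
   ordered group of \<nu>-classes, the order being that of addition. *)
theory Submission
  imports Defs
begin

section \<open>Arithmetic of polynomial functions\<close>

lemma monomial_mult:
  "monomial c m a * monomial d k a = monomial (c * d) (\<lambda>i. m i + k i) a"
  by (simp add: monomial_def power_add prod.distrib mult_ac)

lemma monomial_add: "monomial c m a + monomial d m a = monomial (c + d) m a"
  by (simp add: monomial_def distrib_right)

lemma monomial_in_poly_fun: "c \<in> C \<Longrightarrow> monomial c m \<in> poly_fun C"
  unfolding poly_fun_def by (auto intro: poly_on.single)

lemma const_in_poly_fun: "c \<in> C \<Longrightarrow> (\<lambda>_. c) \<in> poly_fun C"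
  using monomial_in_poly_fun[of c C "\<lambda>_. 0"] by (simp add: monomial_def[abs_def])

text \<open>As \<open>poly_on\<close> requires distinct exponents, a repeated monomial has to be
  absorbed into the coefficient already present. This is stated for arbitrary coefficients, since
  the sum of two tangible ones may be a ghost.\<close>

lemma poly_on_add_monomial_same_support:
  "poly_on UNIV M p \<Longrightarrow> m \<in> M \<Longrightarrow> poly_on UNIV M (\<lambda>a. monomial c m a + p a)"
proof (induction rule: poly_on.induct)
  case (single d k)
  then show ?case
    using poly_on.single[of "c + d" UNIV k] by (simp add: monomial_add)
next
  case (insert M p k d)
  show ?case
  proof (cases "m = k")
    case True
    then show ?thesis
      using poly_on.insert[OF insert.hyps(1,2), of "c + d"]
      by (simp add: monomial_add add.assoc[symmetric])
  next
    case False
    then have "poly_on UNIV M (\<lambda>a. monomial c m a + p a)"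
      using insert by simp
    from poly_on.insert[OF this insert.hyps(2,3)] show ?thesis
      by (simp add: add.left_commute)
  qed
qed

lemma poly_fun_add_monomial:
  assumes "p \<in> poly_fun UNIV"
  shows "(\<lambda>a. monomial c m a + p a) \<in> poly_fun UNIV"
proof -
  obtain M where "poly_on UNIV M p"
    using assms by (auto simp: poly_fun_def)
  then show ?thesis
    unfolding poly_fun_def
    by (cases "m \<in> M") (auto intro: poly_on_add_monomial_same_support poly_on.insert)
qed

lemma poly_fun_add:
  assumes "p \<in> poly_fun UNIV" and q: "q \<in> poly_fun UNIV"
  shows "(\<lambda>a. p a + q a) \<in> poly_fun UNIV"
proof -
  obtain M where "poly_on UNIV M p"
    using assms(1) by (auto simp: poly_fun_def)
  then show ?thesis
    by (induction rule: poly_on.induct)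
      (simp_all add: q poly_fun_add_monomial add.assoc)
qed

lemma poly_fun_mult:
  assumes "p \<in> poly_fun UNIV" and q: "q \<in> poly_fun UNIV"
  shows "(\<lambda>a. p a * q a) \<in> poly_fun UNIV"
proof -
  have monomial: "(\<lambda>a. monomial c m a * q a) \<in> poly_fun UNIV" for c m
  proof -
    obtain N where "poly_on UNIV N q"
      using q by (auto simp: poly_fun_def)
    then show ?thesis
      by (induction rule: poly_on.induct)
        (simp_all add: monomial_mult monomial_in_poly_fun poly_fun_add_monomial distrib_left)
  qed
  obtain M where "poly_on UNIV M p"
    using assms(1) by (auto simp: poly_fun_def)
  then show ?thesis
    by (induction rule: poly_on.induct)
      (simp_all add: monomial poly_fun_add distrib_right)
qed

lemma poly_fun_mono:
  assumes "p \<in> poly_fun C" shows "p \<in> poly_fun UNIV"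
proof -
  obtain M where "poly_on C M p"
    using assms by (auto simp: poly_fun_def)
  then show ?thesis
    by (induction rule: poly_on.induct)
      (simp_all add: monomial_in_poly_fun poly_fun_add_monomial)
qed

section \<open>Saturation, intersection and restriction of \<nu>-kernels\<close>

lemma nu_kernel_saturated:
  assumes "nu_kernel T \<nu> A K" "f \<in> A" "f \<in> upto_nu \<nu> K" shows "f \<in> K"
proof -
  have "K = A \<inter> upto_nu \<nu> K"
    using assms(1) by (simp add: nu_kernel_def)
  with assms(2,3) show ?thesis
    by blast
qed

lemma nu_kernel_subset:
  assumes "nu_kernel T \<nu> A K" shows "K \<subseteq> A"
proof -
  have "K = A \<inter> upto_nu \<nu> K"
    using assms by (simp add: nu_kernel_def)
  then show ?thesis
    by blast
qed

lemma upto_nu_mono: "K \<subseteq> L \<Longrightarrow> upto_nu \<nu> K \<subseteq> upto_nu \<nu> L"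
  by (auto simp: upto_nu_def)

lemma subset_upto_nu: "K \<subseteq> upto_nu \<nu> K"
  by (auto simp: upto_nu_def)

text \<open>The members equivalent to \<open>f\<close> may differ from one kernel to the next.
  Saturation removes this problem: one taken from a single kernel lies in \<open>A\<close>, hence in
  all the others.\<close>

lemma nu_kernel_upto_Inter:
  assumes L: "\<And>L. L \<in> \<L> \<Longrightarrow> nu_kernel T \<nu> A L" and "\<L> \<noteq> {}"
    and f: "\<And>L. L \<in> \<L> \<Longrightarrow> f \<in> upto_nu \<nu> L"
  shows "f \<in> upto_nu \<nu> (\<Inter>\<L>)"
proof -
  obtain L g where "L \<in> \<L>" "g \<in> L" and g: "\<And>a. \<nu> (f a) = \<nu> (g a)"
    using assms by (fastforce simp: upto_nu_def)
  then have "g \<in> A"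
    using nu_kernel_subset[OF L] by blast
  moreover have "g \<in> upto_nu \<nu> M" if "M \<in> \<L>" for M
    using f[OF that] g by (simp add: upto_nu_def)
  ultimately have "g \<in> \<Inter>\<L>"
    using nu_kernel_saturated[OF L] by blast
  with g show ?thesis
    by (auto simp: upto_nu_def)
qed

lemma nu_kernel_Inter:
  assumes L: "\<And>L. L \<in> \<L> \<Longrightarrow> nu_kernel T \<nu> A L" and ne: "\<L> \<noteq> {}"
  shows "nu_kernel T \<nu> A (\<Inter>\<L>)"
  unfolding nu_kernel_def
proof (intro conjI ballI impI)
  show "\<Inter>\<L> = A \<inter> upto_nu \<nu> (\<Inter>\<L>)"
  proof (intro equalityI subsetI)
    fix f assume "f \<in> \<Inter>\<L>"
    then show "f \<in> A \<inter> upto_nu \<nu> (\<Inter>\<L>)"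
      using nu_kernel_subset[OF L] ne subset_upto_nu by blast
  next
    fix f assume "f \<in> A \<inter> upto_nu \<nu> (\<Inter>\<L>)"
    then show "f \<in> \<Inter>\<L>"
      using nu_kernel_saturated[OF L] upto_nu_mono[OF Inter_lower] by blast
  qed
  show "(\<lambda>_. 1) \<in> \<Inter>\<L>"
    using L by (auto simp: nu_kernel_def)
next
  fix f g assume "f \<in> \<Inter>\<L>" "g \<in> \<Inter>\<L>"
  then show "(\<lambda>a. f a * g a) \<in> upto_nu \<nu> (\<Inter>\<L>)"
    by (intro nu_kernel_upto_Inter[OF L ne]) (use L in \<open>auto simp: nu_kernel_def\<close>)
next
  fix f assume "f \<in> \<Inter>\<L>"
  then show "(\<lambda>a. star T \<nu> (f a)) \<in> upto_nu \<nu> (\<Inter>\<L>)"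
    by (intro nu_kernel_upto_Inter[OF L ne]) (use L in \<open>auto simp: nu_kernel_def\<close>)
next
  fix f g \<alpha> \<beta> assume "f \<in> \<Inter>\<L>" "g \<in> \<Inter>\<L>" "\<alpha> \<in> A" "\<beta> \<in> A" "\<forall>a. \<nu> (\<alpha> a + \<beta> a) = \<nu> 1"
  then show "(\<lambda>a. \<alpha> a * f a + \<beta> a * g a) \<in> upto_nu \<nu> (\<Inter>\<L>)"
    by (intro nu_kernel_upto_Inter[OF L ne]) (use L in \<open>auto simp: nu_kernel_def\<close>)
qed

lemma nu_kernel_Int:
  assumes "nu_kernel T \<nu> A K" "nu_kernel T \<nu> A L"
  shows "nu_kernel T \<nu> A (K \<inter> L)"
  using nu_kernel_Inter[of "{K, L}" T \<nu> A] assms by auto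

text \<open>A smaller ambient set leaves fewer coefficients \<alpha>, \<beta> to test. This serves
  to pass from kernels of all rational functions to kernels of \<open>const_kernel\<close>.\<close>

lemma nu_kernel_restrict:
  assumes "nu_kernel T \<nu> A K" "K \<subseteq> B" "B \<subseteq> A"
  shows "nu_kernel T \<nu> B K"
proof -
  have "K = A \<inter> upto_nu \<nu> K"
    using assms(1) by (simp add: nu_kernel_def)
  then have "K = B \<inter> upto_nu \<nu> K"
    using assms(2,3) by blast
  then show ?thesis
    using assms(1,3) unfolding nu_kernel_def by blast
qed

section \<open>The group of \<nu>-classes\<close>

context nu_semifield
begin

text \<open>The ghost of 1 may differ from 1; it acts as a unit on ghosts only, by multiplicativity
  of \<nu>.\<close>

lemma nu_one_mult [simp]: "\<nu> 1 * \<nu> x = \<nu> x" "\<nu> x * \<nu> 1 = \<nu> x"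
  by (simp_all flip: nu_mult)

lemma tang_inv:
  assumes "a \<in> T" shows "tang_inv T a \<in> T" "a * tang_inv T a = 1"
proof -
  have "\<exists>!b. b \<in> T \<and> a * b = 1"
    using T_group[OF assms] T_cancel[OF assms] by metis
  from theI'[OF this] show "tang_inv T a \<in> T" "a * tang_inv T a = 1"
    by (simp_all add: tang_inv_def)
qed

lemma tangible_representative: "\<exists>t\<in>T. \<nu> t = \<nu> x"
  using nu_T_onto nu_range[of x] by (metis imageE)

text \<open>Whatever tangible preimage the choice in \<open>star\<close> returns, its inverse has
  the right \<nu>-class. Hence \<open>star\<close> induces inversion on \<nu>-classes, also for
  elements that are neither tangible nor ghost.\<close>

lemma nu_mult_star: "\<nu> x * \<nu> (star T \<nu> x) = \<nu> 1"
proof (cases "x \<in> T")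
  case True
  then show ?thesis
    by (simp add: star_def tang_inv flip: nu_mult)
next
  case False
  define t where "t = (SOME t. t \<in> T \<and> \<nu> t = \<nu> x)"
  have "t \<in> T \<and> \<nu> t = \<nu> x"
    unfolding t_def by (rule someI_ex) (use tangible_representative in blast)
  then have "\<nu> x * \<nu> (tang_inv T t) = \<nu> 1"
    by (metis nu_mult tang_inv(2))
  with False show ?thesis
    by (simp add: star_def nu_idem flip: t_def)
qed

text \<open>A true equality, not just a \<nu>-equivalence: it lets constants with denominator 1 be
  members of \<open>rat_fun\<close> itself.\<close>

lemma star_one: "star T \<nu> 1 = 1"
  using tang_inv(2)[OF T_one] by (simp add: star_def T_one)

lemma nu_mult_left_cancel:
  assumes "\<nu> x * \<nu> y = \<nu> x * \<nu> z" shows "\<nu> y = \<nu> z"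
proof -
  have "\<nu> (star T \<nu> x) * (\<nu> x * \<nu> y) = \<nu> (star T \<nu> x) * (\<nu> x * \<nu> z)"
    using assms by simp
  then show ?thesis
    by (metis mult.assoc mult.commute nu_mult_star nu_one_mult(1))
qed

lemma nu_star_eqI:
  assumes "\<nu> x * \<nu> y = \<nu> 1" shows "\<nu> (star T \<nu> x) = \<nu> y"
  using assms nu_mult_left_cancel nu_mult_star by metis

section \<open>Closure of rational functions up to \<nu>-equivalence\<close>

lemma poly_fun_tangible:
  assumes "p \<in> poly_fun UNIV"
  obtains q where "q \<in> poly_fun T" "\<And>a. \<nu> (q a) = \<nu> (p a)"
proof -
  have nu_monomial: "\<nu> (monomial t m a) = \<nu> (monomial c m a)" if "\<nu> t = \<nu> c" for t c m a
    using that by (simp add: monomial_def nu_mult)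
  obtain M where "poly_on UNIV M p"
    using assms by (auto simp: poly_fun_def)
  \<comment> \<open>Each coefficient is replaced by a tangible one of the same \<nu>-class. The
    support \<open>M\<close> is kept, so that exponents stay distinct.\<close>
  then have "\<exists>q. poly_on T M q \<and> (\<forall>a. \<nu> (q a) = \<nu> (p a))"
  proof (induction rule: poly_on.induct)
    case (single c m)
    obtain t where "t \<in> T" "\<nu> t = \<nu> c"
      using tangible_representative by blast
    then show ?case
      using poly_on.single nu_monomial by blast
  next
    case (insert M p m c)
    obtain q where q: "poly_on T M q" "\<And>a. \<nu> (q a) = \<nu> (p a)"
      using insert.IH by blast
    obtain t where t: "t \<in> T" "\<nu> t = \<nu> c"
      using tangible_representative by blast
    have "poly_on T (insert m M) (\<lambda>a. monomial t m a + q a)"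
      by (rule poly_on.insert[OF q(1) insert.hyps(2) t(1)])
    moreover have "\<nu> (monomial t m a + q a) = \<nu> (monomial c m a + p a)" for a
      by (simp add: nu_add q(2) nu_monomial[OF t(2)])
    ultimately show ?case
      by blast
  qed
  then show ?thesis
    using that by (auto simp: poly_fun_def)
qed

text \<open>Denominators are cleared and freed of the tangibility condition, which products of
  polynomials need not preserve. Closure under the operations then becomes ordinary arithmetic of
  fractions.\<close>

lemma upto_nu_rat_fun_iff:
  "f \<in> upto_nu \<nu> (rat_fun T \<nu>) \<longleftrightarrow>
     (\<exists>h\<in>poly_fun UNIV. \<exists>g\<in>poly_fun UNIV. \<forall>a. \<nu> (f a) * \<nu> (g a) = \<nu> (h a))"
  (is "_ \<longleftrightarrow> ?R")
proof
  assume "f \<in> upto_nu \<nu> (rat_fun T \<nu>)"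
  then obtain h g where hg: "h \<in> poly_fun UNIV" "g \<in> poly_fun T"
    and f: "\<And>a. \<nu> (f a) = \<nu> (h a * star T \<nu> (g a))"
    by (auto simp: upto_nu_def rat_fun_def)
  have "\<nu> (f a) * \<nu> (g a) = \<nu> (h a)" for a
    using nu_mult_star[of "g a"]
    by (metis f mult.assoc mult.commute nu_mult nu_one_mult(2))
  with hg show ?R
    using poly_fun_mono by blast
next
  assume ?R
  then obtain h g where h: "h \<in> poly_fun UNIV" and "g \<in> poly_fun UNIV"
    and f: "\<And>a. \<nu> (f a) * \<nu> (g a) = \<nu> (h a)"
    by blast
  then obtain q where q: "q \<in> poly_fun T" "\<And>a. \<nu> (q a) = \<nu> (g a)"
    using poly_fun_tangible by blast
  have "\<nu> (f a) = \<nu> (h a * star T \<nu> (q a))" for a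
    using nu_mult_star[of "q a"] f[of a] q(2)[of a]
    by (metis mult.assoc nu_mult nu_one_mult(2))
  moreover have "(\<lambda>a. h a * star T \<nu> (q a)) \<in> rat_fun T \<nu>"
    using h q(1) by (auto simp: rat_fun_def)
  ultimately show "f \<in> upto_nu \<nu> (rat_fun T \<nu>)"
    unfolding upto_nu_def mem_Collect_eq by (intro bexI allI)
qed

lemma upto_nu_rat_fun_mult:
  assumes "f1 \<in> upto_nu \<nu> (rat_fun T \<nu>)" "f2 \<in> upto_nu \<nu> (rat_fun T \<nu>)"
  shows "(\<lambda>a. f1 a * f2 a) \<in> upto_nu \<nu> (rat_fun T \<nu>)"
proof -
  obtain h1 g1 h2 g2 where p: "h1 \<in> poly_fun UNIV" "g1 \<in> poly_fun UNIV" "h2 \<in> poly_fun UNIV"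
      "g2 \<in> poly_fun UNIV"
    and *: "\<And>a. \<nu> (f1 a) * \<nu> (g1 a) = \<nu> (h1 a)" "\<And>a. \<nu> (f2 a) * \<nu> (g2 a) = \<nu> (h2 a)"
    using assms unfolding upto_nu_rat_fun_iff by blast
  have "\<nu> (f1 a * f2 a) * \<nu> (g1 a * g2 a) = \<nu> (h1 a * h2 a)" for a
    by (simp add: nu_mult mult_ac flip: *)
  with p show ?thesis
    unfolding upto_nu_rat_fun_iff
    by (intro bexI[of _ "\<lambda>a. h1 a * h2 a"] bexI[of _ "\<lambda>a. g1 a * g2 a"])
      (simp_all add: poly_fun_mult)
qed

lemma upto_nu_rat_fun_add:
  assumes "f1 \<in> upto_nu \<nu> (rat_fun T \<nu>)" "f2 \<in> upto_nu \<nu> (rat_fun T \<nu>)"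
  shows "(\<lambda>a. f1 a + f2 a) \<in> upto_nu \<nu> (rat_fun T \<nu>)"
proof -
  obtain h1 g1 h2 g2 where p: "h1 \<in> poly_fun UNIV" "g1 \<in> poly_fun UNIV" "h2 \<in> poly_fun UNIV"
      "g2 \<in> poly_fun UNIV"
    and *: "\<And>a. \<nu> (f1 a) * \<nu> (g1 a) = \<nu> (h1 a)" "\<And>a. \<nu> (f2 a) * \<nu> (g2 a) = \<nu> (h2 a)"
    using assms unfolding upto_nu_rat_fun_iff by blast
  have "\<nu> (f1 a + f2 a) * \<nu> (g1 a * g2 a) = \<nu> (h1 a * g2 a + h2 a * g1 a)" for a
    by (simp add: nu_mult nu_add distrib_left distrib_right mult_ac flip: *)
  with p show ?thesis
    unfolding upto_nu_rat_fun_iff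
    by (intro bexI[of _ "\<lambda>a. h1 a * g2 a + h2 a * g1 a"] bexI[of _ "\<lambda>a. g1 a * g2 a"])
      (simp_all add: poly_fun_mult poly_fun_add)
qed

text \<open>Numerator and denominator change places, which is possible because both are now
  arbitrary polynomials.\<close>

lemma upto_nu_rat_fun_star:
  assumes "f \<in> upto_nu \<nu> (rat_fun T \<nu>)"
  shows "(\<lambda>a. star T \<nu> (f a)) \<in> upto_nu \<nu> (rat_fun T \<nu>)"
proof -
  obtain h g where p: "h \<in> poly_fun UNIV" "g \<in> poly_fun UNIV"
    and *: "\<And>a. \<nu> (f a) * \<nu> (g a) = \<nu> (h a)"
    using assms unfolding upto_nu_rat_fun_iff by blast
  have "\<nu> (star T \<nu> (f a)) * \<nu> (h a) = \<nu> (g a)" for a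
    using nu_mult_star[of "f a"] *[of a]
    by (metis mult.assoc mult.commute nu_one_mult(1))
  with p show ?thesis
    unfolding upto_nu_rat_fun_iff by blast
qed

lemma const_in_rat_fun: "(\<lambda>_. c) \<in> rat_fun T \<nu>"
  unfolding rat_fun_def using const_in_poly_fun[of c UNIV] const_in_poly_fun[OF T_one]
  by (auto intro!: bexI simp: star_one)

text \<open>This shows that the family intersected in \<open>const_kernel\<close> is nonempty, so
  that the intersection is again a kernel of rational functions.\<close>

lemma nu_kernel_rat_fun: "nu_kernel T \<nu> (rat_fun T \<nu>) (rat_fun T \<nu>)"
  unfolding nu_kernel_def
proof (intro conjI ballI impI)
  have in_upto: "f \<in> rat_fun T \<nu> \<Longrightarrow> f \<in> upto_nu \<nu> (rat_fun T \<nu>)" for f :: "('b \<Rightarrow> 'a) \<Rightarrow> 'a"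
    using subset_upto_nu by blast
  show "rat_fun T \<nu> = rat_fun T \<nu> \<inter> upto_nu \<nu> (rat_fun T \<nu>)"
    using subset_upto_nu by blast
  show "(\<lambda>_. 1) \<in> rat_fun T \<nu>"
    by (rule const_in_rat_fun)
  fix f g \<alpha> \<beta> :: "('b \<Rightarrow> 'a) \<Rightarrow> 'a"
  assume f: "f \<in> rat_fun T \<nu>"
  show "(\<lambda>a. star T \<nu> (f a)) \<in> upto_nu \<nu> (rat_fun T \<nu>)"
    by (intro upto_nu_rat_fun_star in_upto f)
  assume g: "g \<in> rat_fun T \<nu>"
  show "(\<lambda>a. f a * g a) \<in> upto_nu \<nu> (rat_fun T \<nu>)"
    by (intro upto_nu_rat_fun_mult in_upto f g)
  assume "\<alpha> \<in> rat_fun T \<nu>" "\<beta> \<in> rat_fun T \<nu>"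
  then show "(\<lambda>a. \<alpha> a * f a + \<beta> a * g a) \<in> upto_nu \<nu> (rat_fun T \<nu>)"
    by (intro upto_nu_rat_fun_add upto_nu_rat_fun_mult in_upto f g)
qed

lemma nu_kernel_const_kernel: "nu_kernel T \<nu> (rat_fun T \<nu>) (const_kernel T \<nu>)"
  unfolding const_kernel_def
  by (rule nu_kernel_Inter) (use nu_kernel_rat_fun const_in_rat_fun in auto)

section \<open>The total order on \<nu>-classes, with addition as maximum\<close>

lemma nu_add_cases:
  assumes "nu_bipotent \<nu>" shows "\<nu> x + \<nu> y = \<nu> x \<or> \<nu> x + \<nu> y = \<nu> y"
proof -
  have "x + y \<in> {x, y, \<nu> x}"
    using assms unfolding nu_bipotent_def by blast
  then have "\<nu> (x + y) \<in> {\<nu> x, \<nu> y}"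
    using nu_idem by auto
  then show ?thesis
    by (simp add: nu_add)
qed

lemma nu_add_self: "\<nu> x + \<nu> x = \<nu> x"
  using add_equal[of "\<nu> x" "\<nu> x"] by (simp add: nu_idem)

text \<open>One of \<open>x\<close> and its inverse is at least 1: if 1 dominates \<open>x\<close>,
  multiplication by the inverse reverses the relation.\<close>

lemma nu_add_star_ge_one:
  assumes "nu_bipotent \<nu>"
  shows "\<nu> 1 + (\<nu> x + \<nu> (star T \<nu> x)) = \<nu> x + \<nu> (star T \<nu> x)"
  using nu_add_cases[OF assms, of 1 x]
proof
  assume "\<nu> 1 + \<nu> x = \<nu> 1"
  then have "(\<nu> 1 + \<nu> x) * \<nu> (star T \<nu> x) = \<nu> 1 * \<nu> (star T \<nu> x)"
    by simp
  then have "\<nu> 1 + \<nu> (star T \<nu> x) = \<nu> (star T \<nu> x)"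
    by (simp add: distrib_right nu_mult_star add.commute)
  then show ?thesis
    by (metis add.left_commute)
qed (simp flip: add.assoc)

text \<open>The maximum of \<open>x\<close> and its inverse is one of the two, and if either is 1,
  so is the other.\<close>

lemma nu_add_star_eq_one_iff:
  assumes "nu_bipotent \<nu>"
  shows "\<nu> x + \<nu> (star T \<nu> x) = \<nu> 1 \<longleftrightarrow> \<nu> x = \<nu> 1"
proof
  assume "\<nu> x + \<nu> (star T \<nu> x) = \<nu> 1"
  then consider "\<nu> x = \<nu> 1" | "\<nu> (star T \<nu> x) = \<nu> 1"
    using nu_add_cases[OF assms] by metis
  then show "\<nu> x = \<nu> 1"
    using nu_mult_star[of x] by cases simp_all
next
  assume "\<nu> x = \<nu> 1"
  then have "\<nu> (star T \<nu> x) = \<nu> 1"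
    by (intro nu_star_eqI) simp
  then show "\<nu> x + \<nu> (star T \<nu> x) = \<nu> 1"
    by (simp add: \<open>\<nu> x = \<nu> 1\<close> nu_add_self)
qed

lemma exists_less_one:
  assumes "nu_bipotent \<nu>" "nu_nontrivial \<nu>"
  obtains d where "\<nu> d \<noteq> \<nu> 1" "\<nu> 1 + \<nu> d = \<nu> 1"
proof -
  obtain c where c: "\<nu> c \<noteq> \<nu> 1"
    using assms(2) by (auto simp: nu_nontrivial_def)
  show thesis
    using nu_add_cases[OF assms(1), of 1 c]
  proof
    assume "\<nu> 1 + \<nu> c = \<nu> 1"
    with c that show thesis by blast
  next
    \<comment> \<open>Here \<open>c\<close> lies above 1, so its inverse lies below 1 and serves as
      \<open>d\<close>.\<close>
    assume "\<nu> 1 + \<nu> c = \<nu> c"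
    then have "(\<nu> 1 + \<nu> c) * \<nu> (star T \<nu> c) = \<nu> c * \<nu> (star T \<nu> c)"
      by simp
    then have "\<nu> 1 + \<nu> (star T \<nu> c) = \<nu> 1"
      by (simp add: distrib_right nu_mult_star add.commute)
    moreover have "\<nu> (star T \<nu> c) \<noteq> \<nu> 1"
      using c nu_mult_star[of c] by auto
    ultimately show thesis
      using that by blast
  qed
qed

section \<open>Truncation of rational functions\<close>

lemma exists_truncation:
  assumes bip: "nu_bipotent \<nu>" and "nu_nontrivial \<nu>" and f: "f \<in> rat_fun T \<nu>"
  obtains w where "w \<in> const_kernel T \<nu>" "\<And>a. \<nu> (w a) = \<nu> 1 \<longleftrightarrow> \<nu> (f a) = \<nu> 1"
proof -
  obtain d where d: "\<nu> d \<noteq> \<nu> 1" "\<nu> 1 + \<nu> d = \<nu> 1"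
    using exists_less_one assms by blast
  have "f \<in> upto_nu \<nu> (rat_fun T \<nu>)"
    using f subset_upto_nu by blast
  then have "(\<lambda>a. star T \<nu> (f a + star T \<nu> (f a))) \<in> upto_nu \<nu> (rat_fun T \<nu>)"
    by (intro upto_nu_rat_fun_star upto_nu_rat_fun_add)
  \<comment> \<open>The inverse of |f| is a quotient of polynomials only up to \<nu>, whereas
    coefficients in the kernel axiom must be genuine members of \<open>rat_fun\<close>; hence the
    representative \<alpha>.\<close>
  then obtain \<alpha> where \<alpha>: "\<alpha> \<in> rat_fun T \<nu>"
    and nu_\<alpha>: "\<And>a. \<nu> (\<alpha> a) = \<nu> (star T \<nu> (f a + star T \<nu> (f a)))"
    by (auto simp: upto_nu_def)
  have \<alpha>_inv: "(\<nu> (f a) + \<nu> (star T \<nu> (f a))) * \<nu> (\<alpha> a) = \<nu> 1" for a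
    unfolding nu_\<alpha> by (simp add: nu_mult_star flip: nu_add)
  \<comment> \<open>Multiplying 1 + |f| = |f| by \<alpha> and expanding gives \<alpha> + 1 = 1 in
    \<nu>-classes, the side condition of the kernel axiom.\<close>
  have "(\<nu> 1 + (\<nu> (f a) + \<nu> (star T \<nu> (f a)))) * \<nu> (\<alpha> a) = \<nu> 1" for a
    by (simp add: nu_add_star_ge_one[OF bip] \<alpha>_inv)
  then have "\<forall>a. \<nu> (\<alpha> a + 1) = \<nu> 1"
    by (metis distrib_right \<alpha>_inv nu_add nu_one_mult(1))
  moreover have "(\<lambda>_. 1) \<in> const_kernel T \<nu>" "(\<lambda>_. d) \<in> const_kernel T \<nu>"
    by (simp_all add: const_kernel_def)
  \<comment> \<open>The kernel axiom is applied to the members 1 and \<open>d\<close> with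
    coefficients \<alpha> and 1. The result lies between \<open>d\<close> and 1, while \<alpha>
    itself has no evident constant lower bound.\<close>
  ultimately have "(\<lambda>a. \<alpha> a * 1 + 1 * d) \<in> upto_nu \<nu> (const_kernel T \<nu>)"
    using nu_kernel_const_kernel \<alpha> const_in_rat_fun[of 1] unfolding nu_kernel_def
    by (elim conjE) (drule (1) bspec, drule bspec, assumption, drule (1) bspec, drule (1) bspec, simp)
  then obtain w where w: "w \<in> const_kernel T \<nu>" "\<And>a. \<nu> (w a) = \<nu> (\<alpha> a) + \<nu> d"
    by (auto simp: upto_nu_def nu_add)
  \<comment> \<open>Since \<open>d\<close> lies strictly below 1, the maximum of \<alpha> and
    \<open>d\<close> can be 1 only through \<alpha>.\<close>
  have "\<nu> (w a) = \<nu> 1 \<longleftrightarrow> \<nu> (\<alpha> a) = \<nu> 1" for a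
    using nu_add_cases[OF bip, of "\<alpha> a" d] d by (auto simp: w(2))
  moreover have "\<nu> (\<alpha> a) = \<nu> 1 \<longleftrightarrow> \<nu> (f a) + \<nu> (star T \<nu> (f a)) = \<nu> 1" for a
    using \<alpha>_inv[of a] by (metis nu_add nu_one_mult)
  ultimately show thesis
    using that w(1) nu_add_star_eq_one_iff[OF bip] by blast
qed

end

theorem proposition8p1p4:
  fixes T G :: "'a::semiring_dagger set"
    and \<nu> :: "'a \<Rightarrow> 'a"
    and ord :: "('a \<times> 'a) set"
    and K :: "(('n::finite \<Rightarrow> 'a) \<Rightarrow> 'a) set"
  assumes "nu_semifield T \<nu> G ord"
    and "nu_nontrivial \<nu>"
    and "nu_bipotent \<nu>"
    and "nu_archimedean T \<nu> ord"
    and "K_kernel T \<nu> (rat_fun T \<nu>) K"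
  shows "K_kernel T \<nu> (const_kernel T \<nu>) (K \<inter> const_kernel T \<nu>) \<and>
         one_loc \<nu> K = one_loc \<nu> (K \<inter> const_kernel T \<nu>)"
proof -
  interpret nu_semifield T \<nu> G ord
    by fact
  let ?C = "const_kernel T \<nu> :: (('n \<Rightarrow> 'a) \<Rightarrow> 'a) set"
  have C: "?C \<subseteq> rat_fun T \<nu>"
    using nu_kernel_subset[OF nu_kernel_const_kernel] .
  obtain Z where K: "nu_kernel T \<nu> (rat_fun T \<nu>) K" and Z: "one_set T \<nu> Z"
    and K_eq: "K = Kern T \<nu> Z \<inter> rat_fun T \<nu>"
    using assms(5) by (auto simp: K_kernel_def)
  \<comment> \<open>Both kernels are first intersected inside \<open>rat_fun\<close>; only then is
    the ambient set shrunk to \<open>?C\<close>.\<close>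
  have "nu_kernel T \<nu> ?C (K \<inter> ?C)"
    using nu_kernel_restrict[OF nu_kernel_Int[OF K nu_kernel_const_kernel] _ C] by simp
  moreover have "K \<inter> ?C = Kern T \<nu> Z \<inter> ?C"
    using C K_eq by blast
  ultimately have "K_kernel T \<nu> ?C (K \<inter> ?C)"
    using Z by (auto simp: K_kernel_def)
  \<comment> \<open>Fewer functions impose fewer conditions, so this is the inclusion that needs
    truncation.\<close>
  moreover have "one_loc \<nu> (K \<inter> ?C) \<subseteq> one_loc \<nu> K"
  proof
    fix a assume a: "a \<in> one_loc \<nu> (K \<inter> ?C)"
    have "\<nu> (f a) = \<nu> 1" if "f \<in> K" for f
    proof -
      have f: "f \<in> rat_fun T \<nu>" "\<And>z. z \<in> Z \<Longrightarrow> \<nu> (f z) = \<nu> 1"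
        using that K_eq by (auto simp: Kern_def)
      obtain w where w: "w \<in> ?C" "\<And>a. \<nu> (w a) = \<nu> 1 \<longleftrightarrow> \<nu> (f a) = \<nu> 1"
        using exists_truncation[OF assms(3,2) f(1)] by blast
      \<comment> \<open>Membership comes from the form of \<open>K\<close> as
        \<open>Kern T \<nu> Z\<close>, not from the kernel axioms: \<open>w\<close> is 1 on
        \<open>Z\<close> because \<open>f\<close> is.\<close>
      then have "w \<in> K"
        using f(2) C K_eq by (auto simp: Kern_def)
      with a w(1) have "\<nu> (w a) = \<nu> 1"
        by (simp add: one_loc_def)
      with w(2) show ?thesis
        by simp
    qed
    then show "a \<in> one_loc \<nu> K"
      by (simp add: one_loc_def)
  qed
  moreover have "one_loc \<nu> K \<subseteq> one_loc \<nu> (K \<inter> ?C)"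
    by (auto simp: one_loc_def)
  ultimately show ?thesis
    by blast
qed

end
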